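(* If $S$ is a right coherent monoid and $T$ is a finite monoid, then the direct product $S\times T$ is right coherent.
   Context: Let $S$ be a monoid. A right $S$-act is a set $A$ with a map $A\times S\to A$, $(a,s)\mapsto as$, with $a1=a$ and $a(st)=(as)t$. The free right $S$-act on a set $X$ is $F_S(X)=X\times S$ with $(x,s)t=(x,st)$. A congruence on a right $S$-act is an equivalence relation preserved by the action; it is finitely generated if it is the smallest congruence containing some finite set of pairs. An act $A$ is finitely generated if $A=a_1S\cup\dots\cup a_nS$ for some $a_i\in A$, and finitely presented if it is isomorphic to $F_S(X)/\rho$ with $X$ finite and $\rho$ a finitely generated congruence. The empty set is allowed as a subact (and is finitely generated). The monoid $S$ is right coherent if every finitely generated subact of every finitely presented right $S$-act is finitely presented. *)

theory Defs
  imports "HOL-Algebra.Group"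
begin

record ('a, 's) ract = "'a partial_object" +
  act :: "'a \<Rightarrow> 's \<Rightarrow> 'a"

locale right_act = monoid S for S :: "('s, 'm) monoid_scheme" (structure) +
  fixes A :: "('a, 's, 'n) ract_scheme"
  assumes act_closed: "a \<in> carrier A \<Longrightarrow> s \<in> carrier S \<Longrightarrow> act A a s \<in> carrier A"
    and act_one: "a \<in> carrier A \<Longrightarrow> act A a \<one> = a"
    and act_mult: "a \<in> carrier A \<Longrightarrow> s \<in> carrier S \<Longrightarrow> t \<in> carrier S \<Longrightarrow>
      act A a (s \<otimes> t) = act A (act A a s) t"

text \<open>The subact on a subset \<open>B\<close> is the act \<open>A\<lparr>carrier := B\<rparr>\<close>.\<close>

definition subact :: "('s, 'm) monoid_scheme \<Rightarrow> ('a, 's, 'n) ract_scheme \<Rightarrow> 'a set \<Rightarrow> bool" where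
  "subact S A B \<longleftrightarrow> B \<subseteq> carrier A \<and> (\<forall>b\<in>B. \<forall>s\<in>carrier S. act A b s \<in> B)"

definition fin_gen_act :: "('s, 'm) monoid_scheme \<Rightarrow> ('a, 's, 'n) ract_scheme \<Rightarrow> bool" where
  "fin_gen_act S A \<longleftrightarrow>
    (\<exists>G. finite G \<and> G \<subseteq> carrier A \<and> carrier A = (\<Union>a\<in>G. act A a ` carrier S))"

definition free_act :: "('s, 'm) monoid_scheme \<Rightarrow> 'x set \<Rightarrow> ('x \<times> 's, 's) ract" where
  "free_act S X = \<lparr>carrier = X \<times> carrier S, act = (\<lambda>(x, s) t. (x, s \<otimes>\<^bsub>S\<^esub> t))\<rparr>"

definition act_congruence ::
  "('s, 'm) monoid_scheme \<Rightarrow> ('a, 's, 'n) ract_scheme \<Rightarrow> 'a rel \<Rightarrow> bool" where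
  "act_congruence S A \<rho> \<longleftrightarrow> equiv (carrier A) \<rho> \<and>
    (\<forall>(a, b)\<in>\<rho>. \<forall>s\<in>carrier S. (act A a s, act A b s) \<in> \<rho>)"

definition fin_gen_congruence ::
  "('s, 'm) monoid_scheme \<Rightarrow> ('a, 's, 'n) ract_scheme \<Rightarrow> 'a rel \<Rightarrow> bool" where
  "fin_gen_congruence S A \<rho> \<longleftrightarrow> act_congruence S A \<rho> \<and>
    (\<exists>H. finite H \<and> H \<subseteq> \<rho> \<and> (\<forall>\<sigma>. act_congruence S A \<sigma> \<and> H \<subseteq> \<sigma> \<longrightarrow> \<rho> \<subseteq> \<sigma>))"

text \<open>For a congruence \<open>\<rho>\<close>, the class \<open>C\<close> of \<open>a\<close> is sent by \<open>s\<close> to the class of \<open>as\<close>.\<close>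

definition quot_act :: "('a, 's, 'n) ract_scheme \<Rightarrow> 'a rel \<Rightarrow> ('a set, 's) ract" where
  "quot_act A \<rho> = \<lparr>carrier = carrier A // \<rho>, act = (\<lambda>C s. \<Union>a\<in>C. \<rho> `` {act A a s})\<rparr>"

definition act_iso :: "('s, 'm) monoid_scheme \<Rightarrow> ('a, 's, 'n) ract_scheme \<Rightarrow>
    ('b, 's, 'k) ract_scheme \<Rightarrow> ('a \<Rightarrow> 'b) set" where
  "act_iso S A B = {f. bij_betw f (carrier A) (carrier B) \<and>
    (\<forall>a\<in>carrier A. \<forall>s\<in>carrier S. f (act A a s) = act B (f a) s)}"

text \<open>
  Up to isomorphism the finite basis \<open>X\<close> may be taken inside the natural numbers; a basis of any
  other type gives the same notion, see \<open>fin_pres_actI\<close> below.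
\<close>

definition fin_pres_act :: "('s, 'm) monoid_scheme \<Rightarrow> ('a, 's, 'n) ract_scheme \<Rightarrow> bool" where
  "fin_pres_act S A \<longleftrightarrow>
    (\<exists>(X :: nat set) \<rho>. finite X \<and> fin_gen_congruence S (free_act S X) \<rho> \<and>
      act_iso S A (quot_act (free_act S X) \<rho>) \<noteq> {})"

text \<open>
  A definition cannot quantify over all carrier types. It is enough to let \<open>A\<close> range over acts
  carried by the type of \<open>quot_act (free_act S X) \<rho>\<close> with \<open>X :: nat set\<close>, as every finitely
  presented act is isomorphic to one of these; \<open>right_coherentD\<close> below gives the property for acts
  of arbitrary type.
\<close>

definition right_coherent :: "('s, 'm) monoid_scheme \<Rightarrow> bool" where
  "right_coherent S \<longleftrightarrow>
    (\<forall>A :: ((nat \<times> 's) set, 's) ract. right_act S A \<and> fin_pres_act S A \<longrightarrow>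
      (\<forall>B. subact S A B \<and> fin_gen_act S (A\<lparr>carrier := B\<rparr>) \<longrightarrow>
        fin_pres_act S (A\<lparr>carrier := B\<rparr>)))"

lemma act_iso_trans:
  assumes "f \<in> act_iso S A B" "g \<in> act_iso S B C"
  shows "g \<circ> f \<in> act_iso S A C"
  using assms unfolding act_iso_def
  by (auto intro: bij_betw_trans simp: bij_betw_apply)

lemma id_act_iso: "id \<in> act_iso S A A"
  by (simp add: act_iso_def)

lemma fin_pres_act_iso:
  assumes "fin_pres_act S B" "f \<in> act_iso S A B"
  shows "fin_pres_act S A"
proof -
  obtain X :: "nat set" and \<rho> g where "finite X" "fin_gen_congruence S (free_act S X) \<rho>"
    and "g \<in> act_iso S B (quot_act (free_act S X) \<rho>)"
    using assms(1) by (auto simp: fin_pres_act_def)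
  then show ?thesis
    using act_iso_trans[OF assms(2)] unfolding fin_pres_act_def
    by (intro exI[of _ X] exI[of _ \<rho>]) auto
qed

lemma right_act_free:
  assumes "monoid S"
  shows "right_act S (free_act S X)"
proof -
  interpret monoid S by fact
  show ?thesis
    by unfold_locales (auto simp: free_act_def m_assoc)
qed

lemma act_quot_class:
  assumes "act_congruence S A \<rho>" "a \<in> carrier A" "s \<in> carrier S"
  shows "act (quot_act A \<rho>) (\<rho> `` {a}) s = \<rho> `` {act A a s}"
proof -
  have e: "equiv (carrier A) \<rho>" and c: "\<And>b. (a, b) \<in> \<rho> \<Longrightarrow> (act A a s, act A b s) \<in> \<rho>"
    using assms(1,3) by (auto simp: act_congruence_def)
  have "\<rho> `` {act A b s} = \<rho> `` {act A a s}" if "b \<in> \<rho> `` {a}" for b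
  proof -
    have "(act A a s, act A b s) \<in> \<rho>"
      using that by (intro c) simp
    then show ?thesis
      by (rule equiv_class_eq[OF e, symmetric])
  qed
  moreover have "\<rho> `` {a} \<noteq> {}"
    using equiv_class_self[OF e assms(2)] by (metis empty_iff)
  ultimately show ?thesis
    by (simp add: quot_act_def)
qed

lemma right_act_quot:
  assumes "right_act S A" "act_congruence S A \<rho>"
  shows "right_act S (quot_act A \<rho>)"
proof -
  interpret right_act S A by fact
  have car: "carrier (quot_act A \<rho>) = carrier A // \<rho>" by (simp add: quot_act_def)
  have "act (quot_act A \<rho>) C s \<in> carrier (quot_act A \<rho>)"
    "act (quot_act A \<rho>) C \<one>\<^bsub>S\<^esub> = C"
    "act (quot_act A \<rho>) C (s \<otimes>\<^bsub>S\<^esub> t) = act (quot_act A \<rho>) (act (quot_act A \<rho>) C s) t"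
    if C: "C \<in> carrier (quot_act A \<rho>)" and st: "s \<in> carrier S" "t \<in> carrier S" for C s t
  proof -
    obtain a where a: "a \<in> carrier A" "C = \<rho> `` {a}"
      using C unfolding car by (rule quotientE)
    then have "\<rho> `` {act A a s} \<in> carrier A // \<rho>"
      using st(1) by (intro quotientI act_closed)
    with a st show "act (quot_act A \<rho>) C s \<in> carrier (quot_act A \<rho>)"
      "act (quot_act A \<rho>) C \<one>\<^bsub>S\<^esub> = C"
      "act (quot_act A \<rho>) C (s \<otimes>\<^bsub>S\<^esub> t) = act (quot_act A \<rho>) (act (quot_act A \<rho>) C s) t"
      by (simp_all add: car act_quot_class[OF assms(2)] act_closed act_one act_mult)
  qed
  note * = this
  show ?thesis
    by unfold_locales (assumption | rule * one_closed)+
qed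

lemma act_iso_image_subact:
  assumes "f \<in> act_iso S A P" "subact S A B"
  shows "subact S P (f ` B)" "f \<in> act_iso S (A\<lparr>carrier := B\<rparr>) (P\<lparr>carrier := f ` B\<rparr>)"
proof -
  have b: "bij_betw f (carrier A) (carrier P)"
    and h: "\<And>a s. a \<in> carrier A \<Longrightarrow> s \<in> carrier S \<Longrightarrow> f (act A a s) = act P (f a) s"
    using assms(1) by (auto simp: act_iso_def)
  have B: "B \<subseteq> carrier A" and cl: "\<And>b s. b \<in> B \<Longrightarrow> s \<in> carrier S \<Longrightarrow> act A b s \<in> B"
    using assms(2) by (auto simp: subact_def)
  show "subact S P (f ` B)"
    using B b cl h[symmetric] by (auto simp: subact_def bij_betw_def subset_iff)
  have "inj_on f B" using b B by (auto simp: bij_betw_def intro: inj_on_subset)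
  then show "f \<in> act_iso S (A\<lparr>carrier := B\<rparr>) (P\<lparr>carrier := f ` B\<rparr>)"
    using h B by (auto simp: act_iso_def bij_betw_def)
qed

lemma fin_gen_act_iso:
  assumes "fin_gen_act S A" "f \<in> act_iso S A B"
  shows "fin_gen_act S B"
proof -
  from assms(1) obtain G where G: "finite G" "G \<subseteq> carrier A"
    and c: "carrier A = (\<Union>a\<in>G. act A a ` carrier S)" by (auto simp: fin_gen_act_def)
  have b: "carrier B = f ` carrier A"
    and h: "\<And>a s. a \<in> carrier A \<Longrightarrow> s \<in> carrier S \<Longrightarrow> f (act A a s) = act B (f a) s"
    using assms(2) by (auto simp: act_iso_def bij_betw_def)
  have "carrier B = (\<Union>a\<in>G. f ` act A a ` carrier S)"
    by (simp add: b c image_UN)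
  also have "\<dots> = (\<Union>a\<in>f ` G. act B a ` carrier S)"
    using h G by (auto simp: image_image subset_iff)
  finally have "carrier B = (\<Union>a\<in>f ` G. act B a ` carrier S)" .
  then show ?thesis
    using finite_imageI[OF G(1), of f] image_mono[OF G(2), of f, folded b]
    unfolding fin_gen_act_def by (intro exI[of _ "f ` G"] conjI)
qed

lemma right_coherentD:
  fixes A :: "('a, 's, 'n) ract_scheme"
  assumes "right_coherent S" "right_act S A" "fin_pres_act S A"
    and "subact S A B" "fin_gen_act S (A\<lparr>carrier := B\<rparr>)"
  shows "fin_pres_act S (A\<lparr>carrier := B\<rparr>)"
proof -
  obtain X :: "nat set" and \<rho> f where X: "finite X" and \<rho>: "fin_gen_congruence S (free_act S X) \<rho>"
    and f: "f \<in> act_iso S A (quot_act (free_act S X) \<rho>)"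
    using assms(3) by (auto simp: fin_pres_act_def)
  define P where "P = quot_act (free_act S X) \<rho>"
  have "monoid S" using assms(2) by (simp add: right_act_def)
  then have "right_act S P"
    using \<rho> by (auto simp: P_def fin_gen_congruence_def intro!: right_act_quot right_act_free)
  moreover have "fin_pres_act S P"
    using X \<rho> id_act_iso unfolding P_def fin_pres_act_def by blast
  moreover note iso = act_iso_image_subact[OF f[folded P_def] assms(4)]
  ultimately have "fin_pres_act S (P\<lparr>carrier := f ` B\<rparr>)"
    using assms(1) fin_gen_act_iso[OF assms(5) iso(2)] by (auto simp: right_coherent_def)
  then show ?thesis
    using fin_pres_act_iso iso(2) by blast
qed

lemma act_congruence_vimage:
  assumes "right_act S A" "f \<in> act_iso S A B" "act_congruence S B \<sigma>"
  shows "act_congruence S A {(a, b) \<in> carrier A \<times> carrier A. (f a, f b) \<in> \<sigma>}"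
proof -
  interpret right_act S A by fact
  have m: "\<And>a. a \<in> carrier A \<Longrightarrow> f a \<in> carrier B"
    and h: "\<And>a s. a \<in> carrier A \<Longrightarrow> s \<in> carrier S \<Longrightarrow> f (act A a s) = act B (f a) s"
    using assms(2) by (auto simp: act_iso_def bij_betw_def)
  have e: "equiv (carrier B) \<sigma>"
    and c: "\<And>x y s. (x, y) \<in> \<sigma> \<Longrightarrow> s \<in> carrier S \<Longrightarrow> (act B x s, act B y s) \<in> \<sigma>"
    using assms(3) by (auto simp: act_congruence_def)
  from e have r: "\<And>x. x \<in> carrier B \<Longrightarrow> (x, x) \<in> \<sigma>" and "sym \<sigma>" "trans \<sigma>"
    by (auto simp: equiv_def refl_on_def)
  let ?\<rho> = "{(a, b) \<in> carrier A \<times> carrier A. (f a, f b) \<in> \<sigma>}"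
  have "equiv (carrier A) ?\<rho>"
  proof (rule equivI)
    show "sym ?\<rho>" using \<open>sym \<sigma>\<close> by (auto intro!: symI dest: symD)
    show "trans ?\<rho>" using \<open>trans \<sigma>\<close> by (auto intro!: transI dest: transD)
  qed (auto simp: refl_on_def r m)
  then show ?thesis
    by (auto simp: act_congruence_def h c act_closed)
qed

lemma act_iso_inv:
  assumes "right_act S A" "f \<in> act_iso S A B"
  shows "inv_into (carrier A) f \<in> act_iso S B A"
proof -
  interpret right_act S A by fact
  have b: "bij_betw f (carrier A) (carrier B)"
    and h: "\<And>a s. a \<in> carrier A \<Longrightarrow> s \<in> carrier S \<Longrightarrow> f (act A a s) = act B (f a) s"
    using assms(2) by (auto simp: act_iso_def)
  have "inv_into (carrier A) f (act B (f a) s) = act A a s"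
    if "a \<in> carrier A" "s \<in> carrier S" for a s
    using that b h[symmetric] act_closed by (simp add: bij_betw_def)
  moreover have "inv_into (carrier A) f c \<in> carrier A \<and> f (inv_into (carrier A) f c) = c"
    if "c \<in> carrier B" for c
    using that b by (auto simp: bij_betw_def inv_into_into f_inv_into_f)
  ultimately have "inv_into (carrier A) f (act B c s) = act A (inv_into (carrier A) f c) s"
    if "c \<in> carrier B" "s \<in> carrier S" for c s
    using that by metis
  then show ?thesis
    using bij_betw_inv_into[OF b] by (auto simp: act_iso_def)
qed

lemma fin_gen_congruence_transport:
  assumes A: "right_act S A" and B: "right_act S B" and g: "g \<in> act_iso S A B"
    and \<rho>: "fin_gen_congruence S A \<rho>"
  obtains \<rho>' where "fin_gen_congruence S B \<rho>'"
    and "image g \<in> act_iso S (quot_act A \<rho>) (quot_act B \<rho>')"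
proof -
  define k where "k = inv_into (carrier A) g"
  have k: "k \<in> act_iso S B A"
    unfolding k_def by (rule act_iso_inv[OF A g])
  have gb: "bij_betw g (carrier A) (carrier B)"
    and gh: "\<And>a s. a \<in> carrier A \<Longrightarrow> s \<in> carrier S \<Longrightarrow> g (act A a s) = act B (g a) s"
    using g by (auto simp: act_iso_def)
  have gin: "\<And>a. a \<in> carrier A \<Longrightarrow> g a \<in> carrier B"
    using gb by (auto simp: bij_betw_def)
  have kg: "\<And>a. a \<in> carrier A \<Longrightarrow> k (g a) = a"
    using gb by (simp add: k_def bij_betw_def)
  have gk: "\<And>b. b \<in> carrier B \<Longrightarrow> g (k b) = b" and kin: "\<And>b. b \<in> carrier B \<Longrightarrow> k b \<in> carrier A"
    using gb by (auto simp: k_def bij_betw_def inv_into_into f_inv_into_f)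
  have cong: "act_congruence S A \<rho>"
    using \<rho> by (simp add: fin_gen_congruence_def)
  have sub: "\<rho> \<subseteq> carrier A \<times> carrier A"
    using cong by (simp add: act_congruence_def equiv_def)
  define \<rho>' where "\<rho>' = {(a, b) \<in> carrier B \<times> carrier B. (k a, k b) \<in> \<rho>}"
  have cong': "act_congruence S B \<rho>'"
    unfolding \<rho>'_def by (rule act_congruence_vimage[OF B k cong])
  obtain H where H: "finite H" "H \<subseteq> \<rho>"
    and least: "\<forall>\<sigma>. act_congruence S A \<sigma> \<and> H \<subseteq> \<sigma> \<longrightarrow> \<rho> \<subseteq> \<sigma>"
    using \<rho> unfolding fin_gen_congruence_def by (elim conjE exE)
  have "map_prod g g ` H \<subseteq> \<rho>'"
    using H(2) sub by (force simp: \<rho>'_def kg gin)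
  moreover have "\<rho>' \<subseteq> \<sigma>" if \<sigma>: "act_congruence S B \<sigma>" "map_prod g g ` H \<subseteq> \<sigma>" for \<sigma>
  proof -
    have "H \<subseteq> {(a, b) \<in> carrier A \<times> carrier A. (g a, g b) \<in> \<sigma>}"
      using \<sigma>(2) H(2) sub by fastforce
    then have "\<rho> \<subseteq> {(a, b) \<in> carrier A \<times> carrier A. (g a, g b) \<in> \<sigma>}"
      by (intro least[rule_format] conjI act_congruence_vimage[OF A g \<sigma>(1)])
    then show ?thesis
      by (force simp: \<rho>'_def gk)
  qed
  ultimately have "fin_gen_congruence S B \<rho>'"
    using cong' H(1) unfolding fin_gen_congruence_def
    by (intro conjI exI[of _ "map_prod g g ` H"]) auto
  moreover have "image g \<in> act_iso S (quot_act A \<rho>) (quot_act B \<rho>')"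
  proof -
    have cls: "g ` (\<rho> `` {a}) = \<rho>' `` {g a}" if "a \<in> carrier A" for a
    proof
      show "g ` (\<rho> `` {a}) \<subseteq> \<rho>' `` {g a}"
        using that sub by (auto simp: \<rho>'_def kg gin)
      show "\<rho>' `` {g a} \<subseteq> g ` (\<rho> `` {a})"
        using that gk by (force simp: \<rho>'_def kg)
    qed
    have "inj_on (image g) (carrier A // \<rho>)"
    proof (rule inj_on_image)
      have "\<Union> (carrier A // \<rho>) \<subseteq> carrier A"
        using sub by (auto simp: quotient_def)
      then show "inj_on g (\<Union> (carrier A // \<rho>))"
        using gb by (auto simp: bij_betw_def intro: inj_on_subset)
    qed
    moreover have "image g ` (carrier A // \<rho>) = carrier B // \<rho>'"
    proof -
      have "image g ` (carrier A // \<rho>) = (\<lambda>a. \<rho>' `` {g a}) ` carrier A"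
        by (auto simp: quotient_def cls image_iff)
      also have "\<dots> = (\<lambda>b. \<rho>' `` {b}) ` carrier B"
        by (simp add: bij_betw_imp_surj_on[OF gb, symmetric] image_image)
      also have "\<dots> = carrier B // \<rho>'"
        by (auto simp: quotient_def)
      finally show ?thesis .
    qed
    moreover have "g ` act (quot_act A \<rho>) C s = act (quot_act B \<rho>') (g ` C) s"
      if C: "C \<in> carrier A // \<rho>" and s: "s \<in> carrier S" for C s
    proof -
      obtain a where a: "a \<in> carrier A" "C = \<rho> `` {a}"
        using C by (auto elim: quotientE)
      then show ?thesis
        using s right_act.act_closed[OF A]
        by (simp add: act_quot_class[OF cong] act_quot_class[OF cong'] cls gin gh)
    qed
    ultimately show ?thesis
      by (simp add: act_iso_def bij_betw_def quot_act_def)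
  qed
  ultimately show thesis by (rule that)
qed

lemma fin_pres_actI:
  fixes X :: "'x set"
  assumes "monoid S" "finite X" "fin_gen_congruence S (free_act S X) \<rho>"
    and "f \<in> act_iso S A (quot_act (free_act S X) \<rho>)"
  shows "fin_pres_act S A"
proof -
  obtain h where h: "bij_betw h X {0..<card X}"
    using ex_bij_betw_finite_nat[OF assms(2)] by blast
  let ?Y = "{0..<card X}"
  have "map_prod h id \<in> act_iso S (free_act S X) (free_act S ?Y)"
    using h by (auto simp: act_iso_def free_act_def bij_betw_def inj_on_def map_prod_surj_on)
  then obtain \<rho>' where \<rho>': "fin_gen_congruence S (free_act S ?Y) \<rho>'"
    and iso: "image (map_prod h id) \<in>
      act_iso S (quot_act (free_act S X) \<rho>) (quot_act (free_act S ?Y) \<rho>')"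
    using fin_gen_congruence_transport[OF right_act_free right_act_free _ assms(3)] assms(1)
    by blast
  show ?thesis
    using \<rho>' act_iso_trans[OF assms(4) iso] unfolding fin_pres_act_def
    by (intro exI[of _ ?Y] exI[of _ \<rho>']) auto
qed

end

theory Submission
  imports Defs
begin

text \<open>
  Regard an act over \<open>S \<times>\<times> T\<close> as an \<open>S\<close>-act via \<open>s \<mapsto> (s, \<one>)\<close>. The free act on \<open>X\<close> becomes the
  free \<open>S\<close>-act on \<open>X \<times> T\<close>, and a set \<open>H\<close> generating a congruence over \<open>S \<times>\<times> T\<close> yields the
  generating set \<open>H(\<one>, T)\<close> over \<open>S\<close>; as \<open>T\<close> is finite, finite generation and finite
  presentation pass from \<open>S \<times>\<times> T\<close> to \<open>S\<close>. Conversely, if an act over \<open>S \<times>\<times> T\<close> is finitely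
  presented over \<open>S\<close> with generators \<open>g x\<close>, then adding to the \<open>S\<close>-relations one relation
  \<open>(g x)(\<one>, t) = (g y)(s, \<one>)\<close> for each of the finitely many pairs \<open>(x, t)\<close> gives a finite
  presentation over \<open>S \<times>\<times> T\<close>. So coherence of \<open>S\<close> carries over.
\<close>

section \<open>Presentations of an act by generators and their kernel\<close>

lemma carrier_free_act [simp]: "carrier (free_act S X) = X \<times> carrier S"
  by (simp add: free_act_def)

lemma act_free_act [simp]: "act (free_act S X) (x, s) t = (x, s \<otimes>\<^bsub>S\<^esub> t)"
  by (simp add: free_act_def)

lemma act_congruenceD:
  assumes "act_congruence S A \<rho>"
  shows "equiv (carrier A) \<rho>"
    and "(a, b) \<in> \<rho> \<Longrightarrow> s \<in> carrier S \<Longrightarrow> (act A a s, act A b s) \<in> \<rho>"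
  using assms unfolding act_congruence_def by blast+

text \<open>This is the kernel of the morphism from \<open>free_act S X\<close> to \<open>A\<close>
  that extends \<open>g\<close>.\<close>

definition gen_kernel ::
  "('s, 'm) monoid_scheme \<Rightarrow> ('a, 's, 'n) ract_scheme \<Rightarrow> 'x set \<Rightarrow> ('x \<Rightarrow> 'a) \<Rightarrow> ('x \<times> 's) rel" where
  "gen_kernel S A X g = {((x, s), (y, t)). x \<in> X \<and> y \<in> X \<and> s \<in> carrier S \<and> t \<in> carrier S \<and>
    act A (g x) s = act A (g y) t}"

text \<open>An indexed family instead of a set of generators: distinct basis elements of a
  presentation may have the same image in \<open>A\<close>.\<close>

definition generates ::
  "('s, 'm) monoid_scheme \<Rightarrow> ('a, 's, 'n) ract_scheme \<Rightarrow> 'x set \<Rightarrow> ('x \<Rightarrow> 'a) \<Rightarrow> bool" where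
  "generates S A X g \<longleftrightarrow> g ` X \<subseteq> carrier A \<and> carrier A = (\<Union>x\<in>X. act A (g x) ` carrier S)"

text \<open>A presentation is expressed by equations inside \<open>A\<close> instead of an
  isomorphism with a quotient. Presentations over different monoids can then be compared on one
  carrier.\<close>

definition presents ::
  "('s, 'm) monoid_scheme \<Rightarrow> ('a, 's, 'n) ract_scheme \<Rightarrow> 'x set \<Rightarrow> ('x \<Rightarrow> 'a) \<Rightarrow> bool" where
  "presents S A X g \<longleftrightarrow> finite X \<and> generates S A X g \<and>
    fin_gen_congruence S (free_act S X) (gen_kernel S A X g)"

lemma act_congruence_gen_kernel:
  assumes "right_act S A" "g ` X \<subseteq> carrier A"
  shows "act_congruence S (free_act S X) (gen_kernel S A X g)"
proof -
  interpret right_act S A by fact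
  have "equiv (X \<times> carrier S) (gen_kernel S A X g)"
    by (rule equivI) (auto simp: gen_kernel_def refl_on_def sym_def trans_def)
  then show ?thesis
    using assms(2) by (auto simp: act_congruence_def gen_kernel_def image_subset_iff act_mult)
qed

text \<open>The kernel is always a congruence, so it remains to name finitely many relations that
  hold in \<open>A\<close> and to show that they force all the others.\<close>

lemma presentsI:
  assumes "right_act S A" "finite X" "generates S A X g" "finite H" "H \<subseteq> gen_kernel S A X g"
    and "\<And>\<sigma>. act_congruence S (free_act S X) \<sigma> \<Longrightarrow> H \<subseteq> \<sigma> \<Longrightarrow> gen_kernel S A X g \<subseteq> \<sigma>"
  shows "presents S A X g"
proof -
  have "act_congruence S (free_act S X) (gen_kernel S A X g)"
    using act_congruence_gen_kernel[OF assms(1)] assms(3) unfolding generates_def by blast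
  moreover have "\<forall>\<sigma>. act_congruence S (free_act S X) \<sigma> \<and> H \<subseteq> \<sigma> \<longrightarrow> gen_kernel S A X g \<subseteq> \<sigma>"
    by (intro allI impI, elim conjE, rule assms(6))
  ultimately show ?thesis
    unfolding presents_def fin_gen_congruence_def
    by (intro conjI exI[of _ H] assms(2-5))
qed

lemma presentsD:
  assumes "presents S A X g"
  shows "finite X" "generates S A X g"
    and "\<exists>H. finite H \<and> H \<subseteq> gen_kernel S A X g \<and>
      (\<forall>\<sigma>. act_congruence S (free_act S X) \<sigma> \<and> H \<subseteq> \<sigma> \<longrightarrow> gen_kernel S A X g \<subseteq> \<sigma>)"
  using assms by (simp_all add: presents_def fin_gen_congruence_def)

text \<open>The classes of the basis elements \<open>(x, \<one>)\<close>, pulled back along the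
  isomorphism, generate \<open>A\<close>. As the isomorphism is injective, their kernel is
  \<open>\<rho>\<close> itself.\<close>

lemma fin_pres_act_imp_presents:
  assumes "right_act S A" "fin_pres_act S A"
  obtains X :: "nat set" and g where "presents S A X g"
proof -
  interpret right_act S A by fact
  obtain X :: "nat set" and \<rho> f where X: "finite X"
    and \<rho>: "fin_gen_congruence S (free_act S X) \<rho>"
    and f: "f \<in> act_iso S A (quot_act (free_act S X) \<rho>)"
    using assms(2) by (auto simp: fin_pres_act_def)
  have cong: "act_congruence S (free_act S X) \<rho>"
    using \<rho> by (simp add: fin_gen_congruence_def)
  then have e: "equiv (X \<times> carrier S) \<rho>"
    by (simp add: act_congruence_def)
  have b: "bij_betw f (carrier A) ((X \<times> carrier S) // \<rho>)"
    and h: "\<And>a s. a \<in> carrier A \<Longrightarrow> s \<in> carrier S \<Longrightarrow>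
      f (act A a s) = act (quot_act (free_act S X) \<rho>) (f a) s"
    using f by (auto simp: act_iso_def quot_act_def)
  define g where "g x = inv_into (carrier A) f (\<rho> `` {(x, \<one>\<^bsub>S\<^esub>)})" for x
  have g: "g x \<in> carrier A" "f (g x) = \<rho> `` {(x, \<one>\<^bsub>S\<^esub>)}" if "x \<in> X" for x
  proof -
    have "\<rho> `` {(x, \<one>\<^bsub>S\<^esub>)} \<in> f ` carrier A"
      using that b by (auto simp: bij_betw_def intro: quotientI)
    then show "g x \<in> carrier A" "f (g x) = \<rho> `` {(x, \<one>\<^bsub>S\<^esub>)}"
      by (simp_all add: g_def inv_into_into f_inv_into_f)
  qed
  have fg: "f (act A (g x) s) = \<rho> `` {(x, s)}" if "x \<in> X" "s \<in> carrier S" for x s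
    using that by (simp add: h g act_quot_class[OF cong])
  have inj: "inj_on f (carrier A)"
    using b by (simp add: bij_betw_def)
  have "a \<in> (\<Union>x\<in>X. act A (g x) ` carrier S)" if a: "a \<in> carrier A" for a
  proof -
    have "f a \<in> (X \<times> carrier S) // \<rho>"
      using a b by (auto simp: bij_betw_def)
    then obtain x s where xs: "x \<in> X" "s \<in> carrier S" "f a = \<rho> `` {(x, s)}"
      by (auto elim!: quotientE)
    then have "a = act A (g x) s"
      using a by (intro inj_onD[OF inj]) (simp_all add: fg g act_closed)
    with xs show ?thesis by blast
  qed
  then have "generates S A X g"
    using g act_closed by (auto simp: generates_def)
  moreover have "gen_kernel S A X g = \<rho>"
  proof -
    have "((x, s), (y, t)) \<in> \<rho> \<longleftrightarrow> act A (g x) s = act A (g y) t"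
      if "x \<in> X" "y \<in> X" "s \<in> carrier S" "t \<in> carrier S" for x y s t
    proof -
      have "((x, s), (y, t)) \<in> \<rho> \<longleftrightarrow> \<rho> `` {(x, s)} = \<rho> `` {(y, t)}"
        using that by (simp add: eq_equiv_class_iff[OF e])
      also have "\<dots> \<longleftrightarrow> act A (g x) s = act A (g y) t"
        using that by (simp add: fg[symmetric] inj_on_eq_iff[OF inj] g act_closed)
      finally show ?thesis .
    qed
    moreover have "\<rho> \<subseteq> (X \<times> carrier S) \<times> (X \<times> carrier S)"
      using e by (simp add: equiv_def)
    ultimately show ?thesis
      by (auto simp: gen_kernel_def)
  qed
  ultimately show thesis
    using that[of X g] X \<rho> by (simp add: presents_def)
qed

text \<open>An instance of the first isomorphism theorem. The type of the basis is left arbitrary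
  because restriction to \<open>S\<close> produces the basis
  \<open>X \<times> carrier T\<close>.\<close>

lemma presents_imp_fin_pres_act:
  fixes X :: "'x set"
  assumes "right_act S A" "presents S A X g"
  shows "fin_pres_act S A"
proof -
  interpret right_act S A by fact
  let ?\<kappa> = "gen_kernel S A X g"
  have X: "finite X" and \<kappa>: "fin_gen_congruence S (free_act S X) ?\<kappa>"
    and gen: "carrier A = (\<Union>x\<in>X. act A (g x) ` carrier S)"
    and g: "\<And>x. x \<in> X \<Longrightarrow> g x \<in> carrier A"
    using assms(2) by (auto simp: presents_def generates_def)
  have cong: "act_congruence S (free_act S X) ?\<kappa>"
    using \<kappa> by (simp add: fin_gen_congruence_def)
  \<comment> \<open>The isomorphism onto the quotient sends \<open>a\<close> to its fibre under the
    evaluation map. Fibres are kernel classes, and they are nonempty because \<open>g\<close>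
    generates, which gives injectivity.\<close>
  define f where "f a = {(x, s). x \<in> X \<and> s \<in> carrier S \<and> act A (g x) s = a}" for a
  have f: "f (act A (g x) s) = ?\<kappa> `` {(x, s)}" if "x \<in> X" "s \<in> carrier S" for x s
    using that by (auto simp: f_def gen_kernel_def)
  have "inj_on f (carrier A)"
  proof (rule inj_onI)
    fix a b assume "a \<in> carrier A" "f a = f b"
    moreover obtain x s where "(x, s) \<in> f a"
      using \<open>a \<in> carrier A\<close> by (auto simp: gen f_def)
    ultimately show "a = b"
      by (auto simp: f_def)
  qed
  moreover have "f ` carrier A = (X \<times> carrier S) // ?\<kappa>"
    by (force simp: gen f quotient_def)
  moreover have "f (act A a s) = act (quot_act (free_act S X) ?\<kappa>) (f a) s"
    if a: "a \<in> carrier A" and s: "s \<in> carrier S" for a s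
  proof -
    obtain x t where x: "x \<in> X" "t \<in> carrier S" "a = act A (g x) t"
      using a gen by auto
    then have "act A a s = act A (g x) (t \<otimes>\<^bsub>S\<^esub> s)"
      using s by (simp add: act_mult g)
    then show ?thesis
      using x s by (simp add: f act_quot_class[OF cong])
  qed
  ultimately have "f \<in> act_iso S A (quot_act (free_act S X) ?\<kappa>)"
    by (simp add: act_iso_def bij_betw_def quot_act_def)
  then show ?thesis
    by (rule fin_pres_actI[OF monoid_axioms X \<kappa>])
qed

section \<open>Restriction of scalars from \<open>S \<times>\<times> T\<close> to
  \<open>S\<close>\<close>

definition restrict_act ::
  "('t, 'n) monoid_scheme \<Rightarrow> ('a, 's \<times> 't, 'k) ract_scheme \<Rightarrow> ('a, 's) ract" where
  "restrict_act T A = \<lparr>carrier = carrier A, act = (\<lambda>a s. act A a (s, \<one>\<^bsub>T\<^esub>))\<rparr>"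

lemma carrier_restrict_act [simp]: "carrier (restrict_act T A) = carrier A"
  by (simp add: restrict_act_def)

lemma act_restrict_act [simp]: "act (restrict_act T A) a s = act A a (s, \<one>\<^bsub>T\<^esub>)"
  by (simp add: restrict_act_def)

lemma restrict_act_carrier_update:
  "restrict_act T (A\<lparr>carrier := B\<rparr>) = (restrict_act T A)\<lparr>carrier := B\<rparr>"
  by (simp add: restrict_act_def)

locale prod_act = S: monoid S + T: monoid T + right_act "S \<times>\<times> T" A
  for S :: "('s, 'm) monoid_scheme" and T :: "('t, 'n) monoid_scheme"
    and A :: "('a, 's \<times> 't, 'k) ract_scheme" +
  assumes finite_T: "finite (carrier T)"
begin

lemma closed [simp]:
  "a \<in> carrier A \<Longrightarrow> s \<in> carrier S \<Longrightarrow> t \<in> carrier T \<Longrightarrow> act A a (s, t) \<in> carrier A"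
  by (simp add: act_closed)

lemma act_act [simp]:
  assumes "a \<in> carrier A" "s \<in> carrier S" "t \<in> carrier T" "s' \<in> carrier S" "t' \<in> carrier T"
  shows "act A (act A a (s, t)) (s', t') = act A a (s \<otimes>\<^bsub>S\<^esub> s', t \<otimes>\<^bsub>T\<^esub> t')"
  using assms act_mult[of a "(s, t)" "(s', t')"] by simp

lemma right_act_restrict: "right_act S (restrict_act T A)"
  using act_one by unfold_locales auto

text \<open>The factorization \<open>(s, t) = (\<one>, t)(s, \<one>)\<close> puts the
  \<open>T\<close>-part into the generator and leaves only a scalar from \<open>S\<close>.\<close>

lemma generates_restrict:
  assumes "generates (S \<times>\<times> T) A X g"
  shows "generates S (restrict_act T A) (X \<times> carrier T) (\<lambda>(x, t). act A (g x) (\<one>\<^bsub>S\<^esub>, t))"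
proof -
  have g: "\<And>x. x \<in> X \<Longrightarrow> g x \<in> carrier A"
    and gen: "carrier A = (\<Union>x\<in>X. act A (g x) ` (carrier S \<times> carrier T))"
    using assms by (auto simp: generates_def)
  have union: "(\<Union>x\<in>X. act A (g x) ` (carrier S \<times> carrier T)) = (\<Union>z\<in>X \<times> carrier T.
      act (restrict_act T A) (case z of (x, t) \<Rightarrow> act A (g x) (\<one>\<^bsub>S\<^esub>, t)) ` carrier S)"
    by (auto simp: g)
  have sub: "(\<lambda>(x, t). act A (g x) (\<one>\<^bsub>S\<^esub>, t)) ` (X \<times> carrier T) \<subseteq> carrier A"
    by (auto simp: g)
  show ?thesis
    unfolding generates_def carrier_restrict_act by (intro conjI sub trans[OF gen union])
qed

lemma fin_gen_act_restrict:
  assumes "fin_gen_act (S \<times>\<times> T) A"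
  shows "fin_gen_act S (restrict_act T A)"
proof -
  obtain G where G: "finite G" "generates (S \<times>\<times> T) A G id"
    using assms unfolding fin_gen_act_def generates_def by auto
  let ?g = "\<lambda>(x, t). act A (id x) (\<one>\<^bsub>S\<^esub>, t)"
  note gen = generates_restrict[OF G(2), unfolded generates_def]
  show ?thesis
    unfolding fin_gen_act_def
  proof (intro exI conjI)
    show "finite (?g ` (G \<times> carrier T))"
      using G(1) finite_T by simp
    show "?g ` (G \<times> carrier T) \<subseteq> carrier (restrict_act T A)"
      by (rule conjunct1[OF gen])
    show "carrier (restrict_act T A) =
      (\<Union>a\<in>?g ` (G \<times> carrier T). act (restrict_act T A) a ` carrier S)"
      unfolding image_image by (rule conjunct2[OF gen])
  qed
qed

text \<open>A congruence over \<open>S\<close> need not be stable under \<open>T\<close>, so every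
  relation is included together with its translates by all \<open>(\<one>, t)\<close>. There are
  finitely many of these since \<open>T\<close> is finite.\<close>

lemma presents_restrict:
  fixes X :: "'x set"
  assumes "presents (S \<times>\<times> T) A X g"
  shows "presents S (restrict_act T A) (X \<times> carrier T) (\<lambda>(x, t). act A (g x) (\<one>\<^bsub>S\<^esub>, t))"
proof -
  note X = presentsD(1)[OF assms] and gen = presentsD(2)[OF assms]
  obtain H where H: "finite H"
    and HK: "H \<subseteq> gen_kernel (S \<times>\<times> T) A X g"
    and least: "\<And>\<sigma>. act_congruence (S \<times>\<times> T) (free_act (S \<times>\<times> T) X) \<sigma> \<Longrightarrow> H \<subseteq> \<sigma> \<Longrightarrow>
      gen_kernel (S \<times>\<times> T) A X g \<subseteq> \<sigma>"
    using presentsD(3)[OF assms] by auto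
  have g: "\<And>x. x \<in> X \<Longrightarrow> g x \<in> carrier A"
    using gen by (auto simp: generates_def)
  let ?K = "gen_kernel S (restrict_act T A) (X \<times> carrier T) (\<lambda>(x, t). act A (g x) (\<one>\<^bsub>S\<^esub>, t))"
  \<comment> \<open>\<open>\<theta> t u\<close> is the translate of \<open>u\<close> by
    \<open>(\<one>, t)\<close>, read in the free \<open>S\<close>-act on
    \<open>X \<times> carrier T\<close>: the \<open>T\<close>-component becomes part of the basis
    element.\<close>
  define \<theta> where "\<theta> t u = (case u of (x, (s, t')) \<Rightarrow> ((x, t' \<otimes>\<^bsub>T\<^esub> t), s))"
    for t and u :: "'x \<times> 's \<times> 't"
  define H' where "H' = (\<lambda>(t, u, v). (\<theta> t u, \<theta> t v)) ` (carrier T \<times> H)"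
  show ?thesis
  proof (rule presentsI[of _ _ _ _ H'])
    show "right_act S (restrict_act T A)" by (rule right_act_restrict)
    show "finite (X \<times> carrier T)" using X finite_T by simp
    show "generates S (restrict_act T A) (X \<times> carrier T) (\<lambda>(x, t). act A (g x) (\<one>\<^bsub>S\<^esub>, t))"
      by (rule generates_restrict[OF gen])
    show "finite H'" using H finite_T by (simp add: H'_def)
    show "H' \<subseteq> ?K"
    proof -
      have "(\<theta> t u, \<theta> t v) \<in> ?K"
        if t: "t \<in> carrier T" and uv: "(u, v) \<in> gen_kernel (S \<times>\<times> T) A X g" for t u v
      proof -
        obtain x p q y p' q' where u: "u = (x, (p, q))" "v = (y, (p', q'))"
          by (metis surj_pair)
        have c: "x \<in> X" "y \<in> X" "p \<in> carrier S" "p' \<in> carrier S" "q \<in> carrier T" "q' \<in> carrier T"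
          and eq: "act A (g x) (p, q) = act A (g y) (p', q')"
          using uv by (auto simp: u gen_kernel_def)
        have "act A (act A (g x) (p, q)) (\<one>\<^bsub>S\<^esub>, t) = act A (act A (g y) (p', q')) (\<one>\<^bsub>S\<^esub>, t)"
          by (simp add: eq)
        then show ?thesis
          using c t g by (simp add: u \<theta>_def gen_kernel_def)
      qed
      then show ?thesis
        using HK by (auto simp: H'_def)
    qed
  next
    fix \<sigma> assume \<sigma>: "act_congruence S (free_act S (X \<times> carrier T)) \<sigma>" and "H' \<subseteq> \<sigma>"
    have e: "equiv ((X \<times> carrier T) \<times> carrier S) \<sigma>"
      using act_congruenceD(1)[OF \<sigma>] by simp
    then have re: "\<And>u. u \<in> (X \<times> carrier T) \<times> carrier S \<Longrightarrow> (u, u) \<in> \<sigma>"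
      and sy: "sym \<sigma>" and tr: "trans \<sigma>"
      by (auto simp: equiv_def refl_on_def)
    have c: "((z, p \<otimes>\<^bsub>S\<^esub> s), (w, q \<otimes>\<^bsub>S\<^esub> s)) \<in> \<sigma>"
      if "((z, p), (w, q)) \<in> \<sigma>" "s \<in> carrier S" for z p w q s
      using act_congruenceD(2)[OF \<sigma> that] by simp
    \<comment> \<open>Quantifying over \<open>t\<close> makes this congruence stable under all of \<open>S \<times>\<times> T\<close>.\<close>
    define \<tau> where "\<tau> = {(u, v). u \<in> X \<times> (carrier S \<times> carrier T) \<and>
      v \<in> X \<times> (carrier S \<times> carrier T) \<and> (\<forall>t\<in>carrier T. (\<theta> t u, \<theta> t v) \<in> \<sigma>)}"
    have "equiv (X \<times> (carrier S \<times> carrier T)) \<tau>"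
    proof (rule equivI)
      show "refl_on (X \<times> (carrier S \<times> carrier T)) \<tau>"
        by (auto simp: refl_on_def \<tau>_def \<theta>_def intro!: re)
      show "sym \<tau>"
        using sy unfolding sym_def \<tau>_def by blast
      show "trans \<tau>"
        using tr unfolding trans_def \<tau>_def by blast
    qed (auto simp: \<tau>_def)
    \<comment> \<open>Applying \<open>\<theta> r\<close> to the translate of \<open>u\<close> by
      \<open>(s, t)\<close> gives the translate of \<open>\<theta> (t \<otimes> r) u\<close> by
      \<open>s\<close>. So the condition on \<open>u\<close> and \<open>v\<close> at
      \<open>t \<otimes> r\<close>, followed by \<open>c\<close>, yields the one required at
      \<open>r\<close>.\<close>
    moreover have "((x, (p \<otimes>\<^bsub>S\<^esub> s, q \<otimes>\<^bsub>T\<^esub> t)), (y, (p' \<otimes>\<^bsub>S\<^esub> s, q' \<otimes>\<^bsub>T\<^esub> t))) \<in> \<tau>"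
      if "((x, (p, q)), (y, (p', q'))) \<in> \<tau>" "s \<in> carrier S" "t \<in> carrier T" for x p q y p' q' s t
      using that by (simp add: \<tau>_def \<theta>_def T.m_assoc c)
    ultimately have "act_congruence (S \<times>\<times> T) (free_act (S \<times>\<times> T) X) \<tau>"
      by (simp add: act_congruence_def split_paired_all Ball_def)
    moreover have "H \<subseteq> \<tau>"
      using \<open>H' \<subseteq> \<sigma>\<close> HK by (fastforce simp: \<tau>_def H'_def gen_kernel_def)
    ultimately have K: "gen_kernel (S \<times>\<times> T) A X g \<subseteq> \<tau>"
      by (rule least)
    show "?K \<subseteq> \<sigma>"
    proof (clarsimp simp: gen_kernel_def g)
      fix x t s y t' s'
      assume "x \<in> X" "t \<in> carrier T" "y \<in> X" "t' \<in> carrier T" "s \<in> carrier S" "s' \<in> carrier S"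
        and "act A (g x) (s, t) = act A (g y) (s', t')"
      then have "((x, (s, t)), (y, (s', t'))) \<in> \<tau>"
        using K by (auto simp: gen_kernel_def)
      \<comment> \<open>The instance at the identity suffices, as \<open>\<theta> \<one>\<close>
        merely regroups \<open>(x, (s, t))\<close> as \<open>((x, t), s)\<close>.\<close>
      then have "(\<theta> \<one>\<^bsub>T\<^esub> (x, (s, t)), \<theta> \<one>\<^bsub>T\<^esub> (y, (s', t'))) \<in> \<sigma>"
        by (simp add: \<tau>_def)
      then show "(((x, t), s), ((y, t'), s')) \<in> \<sigma>"
        using \<open>t \<in> carrier T\<close> \<open>t' \<in> carrier T\<close> by (simp add: \<theta>_def)
    qed
  qed
qed

text \<open>The added relations move every element of the free act over
  \<open>S \<times>\<times> T\<close> to one with \<open>T\<close>-component \<open>\<one>\<close>.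
  Among such elements the given relations over \<open>S\<close> decide equality in
  \<open>A\<close>.\<close>

lemma presents_of_restrict:
  fixes X :: "'x set"
  assumes "presents S (restrict_act T A) X g"
  shows "presents (S \<times>\<times> T) A X g"
proof -
  note X = presentsD(1)[OF assms] and gen = presentsD(2)[OF assms]
  obtain H where H: "finite H"
    and HK: "H \<subseteq> gen_kernel S (restrict_act T A) X g"
    and least: "\<And>\<sigma>. act_congruence S (free_act S X) \<sigma> \<Longrightarrow> H \<subseteq> \<sigma> \<Longrightarrow>
      gen_kernel S (restrict_act T A) X g \<subseteq> \<sigma>"
    using presentsD(3)[OF assms] by auto
  have g: "\<And>x. x \<in> X \<Longrightarrow> g x \<in> carrier A"
    and gen': "carrier A = (\<Union>x\<in>X. (\<lambda>s. act A (g x) (s, \<one>\<^bsub>T\<^esub>)) ` carrier S)"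
    using gen by (auto simp: generates_def)
  have "\<exists>y s. y \<in> X \<and> s \<in> carrier S \<and> act A (g x) (\<one>\<^bsub>S\<^esub>, t) = act A (g y) (s, \<one>\<^bsub>T\<^esub>)"
    if "x \<in> X" "t \<in> carrier T" for x t
  proof -
    have "act A (g x) (\<one>\<^bsub>S\<^esub>, t) \<in> carrier A"
      using that g by simp
    then have "act A (g x) (\<one>\<^bsub>S\<^esub>, t) \<in> (\<Union>x\<in>X. (\<lambda>s. act A (g x) (s, \<one>\<^bsub>T\<^esub>)) ` carrier S)"
      by (rule subsetD[OF equalityD1[OF gen']])
    then show ?thesis
      by blast
  qed
  \<comment> \<open>A choice, for each pair \<open>(x, t)\<close>, of a generator index
    \<open>\<eta> x t\<close> and a coefficient \<open>\<mu> x t\<close> expressing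
    \<open>(g x)(\<one>, t)\<close> over \<open>S\<close>.\<close>
  then obtain \<eta> \<mu> where \<eta>: "\<And>x t. x \<in> X \<Longrightarrow> t \<in> carrier T \<Longrightarrow> \<eta> x t \<in> X"
    and \<mu>: "\<And>x t. x \<in> X \<Longrightarrow> t \<in> carrier T \<Longrightarrow> \<mu> x t \<in> carrier S"
    and \<eta>\<mu>: "\<And>x t. x \<in> X \<Longrightarrow> t \<in> carrier T \<Longrightarrow>
      act A (g x) (\<one>\<^bsub>S\<^esub>, t) = act A (g (\<eta> x t)) (\<mu> x t, \<one>\<^bsub>T\<^esub>)"
    by metis
  have red: "act A (g x) (s, t) = act A (g (\<eta> x t)) (\<mu> x t \<otimes>\<^bsub>S\<^esub> s, \<one>\<^bsub>T\<^esub>)"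
    if "x \<in> X" "s \<in> carrier S" "t \<in> carrier T" for x s t
  proof -
    have "act A (act A (g x) (\<one>\<^bsub>S\<^esub>, t)) (s, \<one>\<^bsub>T\<^esub>) =
      act A (act A (g (\<eta> x t)) (\<mu> x t, \<one>\<^bsub>T\<^esub>)) (s, \<one>\<^bsub>T\<^esub>)"
      using that by (simp only: \<eta>\<mu>)
    then show ?thesis
      using that by (simp add: g \<eta> \<mu>)
  qed
  let ?K = "gen_kernel (S \<times>\<times> T) A X g"
  \<comment> \<open>\<open>\<iota>\<close> embeds the free \<open>S\<close>-act as the elements with
    \<open>T\<close>-component \<open>\<one>\<close>, and \<open>E\<close> holds one reduction to
    this form per pair \<open>(x, t)\<close>.\<close>
  define \<iota> where "\<iota> = (\<lambda>(x :: 'x, s :: 's). (x, (s, \<one>\<^bsub>T\<^esub>)))"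
  define E where "E = (\<lambda>(x, t). ((x, (\<one>\<^bsub>S\<^esub>, t)), (\<eta> x t, (\<mu> x t, \<one>\<^bsub>T\<^esub>)))) ` (X \<times> carrier T)"
  show ?thesis
  proof (rule presentsI[of _ _ _ _ "map_prod \<iota> \<iota> ` H \<union> E"])
    show "right_act (S \<times>\<times> T) A" by (rule right_act_axioms)
    show "finite X" by (rule X)
    show "generates (S \<times>\<times> T) A X g"
    proof -
      have "(\<Union>x\<in>X. (\<lambda>s. act A (g x) (s, \<one>\<^bsub>T\<^esub>)) ` carrier S) \<subseteq>
        (\<Union>x\<in>X. act A (g x) ` (carrier S \<times> carrier T))"
        by (intro UN_mono) auto
      moreover have "(\<Union>x\<in>X. act A (g x) ` (carrier S \<times> carrier T)) \<subseteq> carrier A"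
        by (auto simp: g)
      ultimately have "carrier A = (\<Union>x\<in>X. act A (g x) ` (carrier S \<times> carrier T))"
        using equalityD1[OF gen'] by (intro equalityI) (rule subset_trans)
      moreover have "g ` X \<subseteq> carrier A"
        using g by (rule image_subsetI)
      ultimately show ?thesis
        unfolding generates_def by simp
    qed
    show "finite (map_prod \<iota> \<iota> ` H \<union> E)"
      using H X finite_T by (simp add: E_def)
    show "map_prod \<iota> \<iota> ` H \<union> E \<subseteq> ?K"
    proof (rule Un_least)
      have "(\<iota> u, \<iota> v) \<in> ?K" if "(u, v) \<in> gen_kernel S (restrict_act T A) X g" for u v
        using that by (auto simp: \<iota>_def gen_kernel_def)
      then show "map_prod \<iota> \<iota> ` H \<subseteq> ?K"
        using HK by auto
      show "E \<subseteq> ?K"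
        by (auto simp: E_def gen_kernel_def \<eta> \<mu> \<eta>\<mu>)
    qed
  next
    fix \<sigma> assume \<sigma>: "act_congruence (S \<times>\<times> T) (free_act (S \<times>\<times> T) X) \<sigma>"
      and sub: "map_prod \<iota> \<iota> ` H \<union> E \<subseteq> \<sigma>"
    have e: "equiv (X \<times> (carrier S \<times> carrier T)) \<sigma>"
      using act_congruenceD(1)[OF \<sigma>] by simp
    then have re: "\<And>u. u \<in> X \<times> (carrier S \<times> carrier T) \<Longrightarrow> (u, u) \<in> \<sigma>"
      and sy: "sym \<sigma>" and tr: "trans \<sigma>"
      by (auto simp: equiv_def refl_on_def)
    have c: "((x, (p \<otimes>\<^bsub>S\<^esub> s, q \<otimes>\<^bsub>T\<^esub> t)), (y, (p' \<otimes>\<^bsub>S\<^esub> s, q' \<otimes>\<^bsub>T\<^esub> t))) \<in> \<sigma>"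
      if "((x, (p, q)), (y, (p', q'))) \<in> \<sigma>" "s \<in> carrier S" "t \<in> carrier T" for x p q y p' q' s t
      using act_congruenceD(2)[OF \<sigma> that(1), of "(s, t)"] that by simp
    \<comment> \<open>The pullback of \<open>\<sigma>\<close> along \<open>\<iota>\<close> is a
      congruence over \<open>S\<close>, because \<open>\<iota>\<close> turns the action of
      \<open>s\<close> into that of \<open>(s, \<one>)\<close>.\<close>
    define \<tau> where "\<tau> = {(u, v). u \<in> X \<times> carrier S \<and> v \<in> X \<times> carrier S \<and> (\<iota> u, \<iota> v) \<in> \<sigma>}"
    have "equiv (X \<times> carrier S) \<tau>"
    proof (rule equivI)
      show "refl_on (X \<times> carrier S) \<tau>"
        by (auto simp: refl_on_def \<tau>_def \<iota>_def intro!: re)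
      show "sym \<tau>"
        using sy unfolding sym_def \<tau>_def by blast
      show "trans \<tau>"
        using tr unfolding trans_def \<tau>_def by blast
    qed (auto simp: \<tau>_def)
    moreover have "((x, p \<otimes>\<^bsub>S\<^esub> s), (y, q \<otimes>\<^bsub>S\<^esub> s)) \<in> \<tau>"
      if "((x, p), (y, q)) \<in> \<tau>" "s \<in> carrier S" for x p y q s
      using that c[of x p "\<one>\<^bsub>T\<^esub>" y q "\<one>\<^bsub>T\<^esub>" s "\<one>\<^bsub>T\<^esub>"] by (simp add: \<tau>_def \<iota>_def)
    ultimately have "act_congruence S (free_act S X) \<tau>"
      by (simp add: act_congruence_def split_paired_all Ball_def)
    moreover have "H \<subseteq> \<tau>"
      using sub HK by (fastforce simp: \<tau>_def gen_kernel_def)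
    ultimately have K: "gen_kernel S (restrict_act T A) X g \<subseteq> \<tau>"
      by (rule least)
    \<comment> \<open>Translating a relation of \<open>E\<close> by \<open>(s, \<one>)\<close>
      reduces an arbitrary element modulo \<open>\<sigma>\<close>.\<close>
    have E: "((x, (s, t)), (\<eta> x t, (\<mu> x t \<otimes>\<^bsub>S\<^esub> s, \<one>\<^bsub>T\<^esub>))) \<in> \<sigma>"
      if "x \<in> X" "s \<in> carrier S" "t \<in> carrier T" for x s t
    proof -
      have "((x, (\<one>\<^bsub>S\<^esub>, t)), (\<eta> x t, (\<mu> x t, \<one>\<^bsub>T\<^esub>))) \<in> \<sigma>"
        using sub that by (auto simp: E_def)
      from c[OF this that(2) T.one_closed] show ?thesis
        using that by simp
    qed
    show "?K \<subseteq> \<sigma>"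
    proof -
      have "((x, (s, t)), (y, (s', t'))) \<in> \<sigma>"
        if x: "x \<in> X" "s \<in> carrier S" "t \<in> carrier T"
          and y: "y \<in> X" "s' \<in> carrier S" "t' \<in> carrier T"
          and eq: "act A (g x) (s, t) = act A (g y) (s', t')" for x s t y s' t'
      proof -
        \<comment> \<open>By \<open>red\<close>, the reduced forms of both sides have equal values
          in \<open>A\<close>, so \<open>K\<close> relates them under \<open>\<sigma>\<close>. The
          reductions \<open>E\<close> at both ends complete the chain.\<close>
        have "((\<eta> x t, \<mu> x t \<otimes>\<^bsub>S\<^esub> s), (\<eta> y t', \<mu> y t' \<otimes>\<^bsub>S\<^esub> s')) \<in> gen_kernel S (restrict_act T A) X g"
          using x y eq by (simp add: gen_kernel_def \<eta> \<mu> red)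
        then have "((\<eta> x t, (\<mu> x t \<otimes>\<^bsub>S\<^esub> s, \<one>\<^bsub>T\<^esub>)), (\<eta> y t', (\<mu> y t' \<otimes>\<^bsub>S\<^esub> s', \<one>\<^bsub>T\<^esub>))) \<in> \<sigma>"
          using K by (auto simp: \<tau>_def \<iota>_def)
        then show ?thesis
          using E[OF x] E[OF y] sy tr by (meson symD transD)
      qed
      then show ?thesis
        by (auto simp: gen_kernel_def)
    qed
  qed
qed

lemma fin_pres_act_restrict_iff:
  "fin_pres_act S (restrict_act T A) \<longleftrightarrow> fin_pres_act (S \<times>\<times> T) A"
proof
  assume "fin_pres_act S (restrict_act T A)"
  then obtain X :: "nat set" and g where "presents S (restrict_act T A) X g"
    by (rule fin_pres_act_imp_presents[OF right_act_restrict])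
  then show "fin_pres_act (S \<times>\<times> T) A"
    by (rule presents_imp_fin_pres_act[OF right_act_axioms presents_of_restrict])
next
  assume "fin_pres_act (S \<times>\<times> T) A"
  then obtain X :: "nat set" and g where "presents (S \<times>\<times> T) A X g"
    by (rule fin_pres_act_imp_presents[OF right_act_axioms])
  then show "fin_pres_act S (restrict_act T A)"
    by (rule presents_imp_fin_pres_act[OF right_act_restrict presents_restrict])
qed

end

section \<open>Coherence of the direct product\<close>

lemma right_act_subact:
  assumes "right_act S A" "subact S A B"
  shows "right_act S (A\<lparr>carrier := B\<rparr>)"
proof -
  interpret right_act S A by fact
  show ?thesis
    using assms(2) by unfold_locales (auto simp: subact_def act_one act_mult)
qed

theorem theorem6p4:
  fixes S :: "('s, 'm) monoid_scheme" and T :: "('t, 'n) monoid_scheme"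
  assumes "monoid S" and "right_coherent S"
    and "monoid T" and "finite (carrier T)"
  shows "right_coherent (S \<times>\<times> T)"
  unfolding right_coherent_def
proof (intro allI impI; elim conjE)
  fix A :: "((nat \<times> 's \<times> 't) set, 's \<times> 't) ract" and B
  assume A: "right_act (S \<times>\<times> T) A" "fin_pres_act (S \<times>\<times> T) A"
    and B: "subact (S \<times>\<times> T) A B" "fin_gen_act (S \<times>\<times> T) (A\<lparr>carrier := B\<rparr>)"
  interpret A: prod_act S T A
    using assms A(1) by (simp add: prod_act_def prod_act_axioms_def)
  \<comment> \<open>The subact needs its own interpretation: finite generation passes down to
    \<open>S\<close> for it, and finite presentation comes back up.\<close>
  interpret B: prod_act S T "A\<lparr>carrier := B\<rparr>"
    using assms right_act_subact[OF A(1) B(1)] by (simp add: prod_act_def prod_act_axioms_def)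
  have "subact S (restrict_act T A) B"
    using B(1) by (auto simp: subact_def)
  \<comment> \<open>The restricted act is carried by sets over
    \<open>nat \<times> 's \<times> 't\<close>, not by the type fixed in
    \<open>right_coherent\<close>, hence the type-independent
    \<open>right_coherentD\<close>.\<close>
  then have "fin_pres_act S ((restrict_act T A)\<lparr>carrier := B\<rparr>)"
    using right_coherentD[OF assms(2) A.right_act_restrict] A(2) A.fin_pres_act_restrict_iff
      B.fin_gen_act_restrict[OF B(2)] by (simp add: restrict_act_carrier_update)
  then show "fin_pres_act (S \<times>\<times> T) (A\<lparr>carrier := B\<rparr>)"
    using B.fin_pres_act_restrict_iff by (simp add: restrict_act_carrier_update)
qed

end
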